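(* For every integer $n\ge1$, $$E[(Y)_{n,\lambda}]=\sum_{l=1}^{n}\sum_{k=l}^{n}\lambda^{k-l}(-1)^{n-k}(1)_{l,\lambda}S_{1,\lambda}^{Y}(n,k)L(k,l).$$
   Context: $\lambda$ is a fixed nonzero real number. For real $x$ and $n\ge1$: $(x)_{n}=x(x-1)\cdots(x-n+1)$, $\langle x\rangle_n=x(x+1)\cdots(x+n-1)$, $(x)_{n,\lambda}=x(x-\lambda)\cdots(x-(n-1)\lambda)$, and $(x)_0=\langle x\rangle_0=(x)_{0,\lambda}=1$. The degenerate exponential is $e_{\lambda}^{x}(t)=(1+\lambda t)^{x/\lambda}=\sum_{n\ge0}(x)_{n,\lambda}\frac{t^n}{n!}$. The degenerate logarithm is, for $\mu\ne0$ and $u>0$, $\log_{\mu}(u)=\frac{1}{\mu}(u^{\mu}-1)$; in particular $\log_{-\lambda}(u)=-\frac1\lambda(u^{-\lambda}-1)$. The Lah numbers $L(n,k)$ are defined by the polynomial identity $\langle x\rangle_n=\sum_{k=0}^nL(n,k)(x)_k$, $n\ge0$. $Y$ is a real random variable whose degenerate moment generating functions exist near the origin: for every nonzero real $\lambda$ there is $r=r(\lambda)>0$ with $E[e_{\lambda}^{Y}(t)]=\sum_{n\ge0}E[(Y)_{n,\lambda}]\frac{t^n}{n!}$ for $|t|<r$. The probabilistic degenerate Stirling numbers of the first kind associated with $Y$ are defined by the power series expansion at $t=0$: $\frac{1}{k!}\big(\log_{-\lambda}(E[e_{\lambda}^{Y}(t)])\big)^k=\sum_{n\ge k}(-1)^{n-k}S_{1,\lambda}^{Y}(n,k)\frac{t^n}{n!}$,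 $k\ge0$. *)

theory Defs
  imports "HOL-Probability.Probability" "HOL-Analysis.FPS_Convergence"
begin

text \<open>The degenerate falling factorial $(x)_{n,\lambda}$; the ordinary one $(x)_n$ is the case
  $\lambda = 1$.  The rising factorial $\langle x\rangle_n$ is \<^const>\<open>pochhammer\<close>.\<close>

definition deg_falling :: "real \<Rightarrow> real \<Rightarrow> nat \<Rightarrow> real" where
  "deg_falling lam x n = (\<Prod>i<n. x - real i * lam)"

abbreviation falling :: "real \<Rightarrow> nat \<Rightarrow> real" where
  "falling x n \<equiv> deg_falling 1 x n"

text \<open>Only meaningful for \<open>1 + lam * t > 0\<close> (always the case near \<open>t = 0\<close>).\<close>

definition deg_exp :: "real \<Rightarrow> real \<Rightarrow> real \<Rightarrow> real" where
  "deg_exp lam x t = (1 + lam * t) powr (x / lam)"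

definition deg_log :: "real \<Rightarrow> real \<Rightarrow> real" where
  "deg_log mu u = (u powr mu - 1) / mu"

text \<open>The coefficients are indexed by all naturals, with value 0 above \<open>n\<close>,
  so that the description is unique.\<close>

definition lah :: "nat \<Rightarrow> nat \<Rightarrow> real" where
  "lah n = (THE c. (\<forall>k>n. c k = 0) \<and>
     (\<forall>x::real. pochhammer x n = (\<Sum>k=0..n. c k * falling x k)))"

text \<open>Integrability is spelled out because the Bochner integral of a non-integrable function
  is 0.  The bound \<open>r * \<bar>mu\<bar> \<le> 1\<close> keeps \<open>1 + mu * t\<close> positive for \<open>\<bar>t\<bar> < r\<close>; it loses
  no generality, since \<open>r\<close> may be shrunk.\<close>

definition has_deg_mgfs :: "'a measure \<Rightarrow> ('a \<Rightarrow> real) \<Rightarrow> bool" where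
  "has_deg_mgfs M Y \<longleftrightarrow>
     (\<forall>mu. mu \<noteq> 0 \<longrightarrow>
        (\<forall>n. integrable M (\<lambda>\<omega>. deg_falling mu (Y \<omega>) n)) \<and>
        (\<exists>r>0. r * \<bar>mu\<bar> \<le> 1 \<and>
           (\<forall>t. \<bar>t\<bar> < r \<longrightarrow>
              integrable M (\<lambda>\<omega>. deg_exp mu (Y \<omega>) t) \<and>
              (\<lambda>n. prob_space.expectation M (\<lambda>\<omega>. deg_falling mu (Y \<omega>) n) * t ^ n / fact n)
                sums prob_space.expectation M (\<lambda>\<omega>. deg_exp mu (Y \<omega>) t))))"

text \<open>The numbers $S_{1,\lambda}^Y(n,k)$, normalised to be 0 for \<open>n < k\<close>
  so that the description is unique.\<close>

definition prob_deg_stirling1 ::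
    "'a measure \<Rightarrow> ('a \<Rightarrow> real) \<Rightarrow> real \<Rightarrow> nat \<Rightarrow> nat \<Rightarrow> real" where
  "prob_deg_stirling1 M Y lam n k =
     (THE s. (\<forall>m<k. s m = 0) \<and>
        (\<lambda>t. 1 / fact k *
             (deg_log (- lam) (prob_space.expectation M (\<lambda>\<omega>. deg_exp lam (Y \<omega>) t))) ^ k)
        has_fps_expansion
        Abs_fps (\<lambda>m. if k \<le> m then (- 1) ^ (m - k) * s m / fact m else 0)) n"

end

theory Submission imports Defs "HOL-Complex_Analysis.Laurent_Convergence" begin

text \<open>With \<open>u(t) = E[e\<^sub>\<lambda>\<^sup>Y(t)]\<close> and \<open>w = log\<^sub>-\<^sub>\<lambda> u\<close> one has \<open>u = (1 - \<lambda>w)\<^bsup>-1/\<lambda>\<^esup>\<close> near 0, and the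
  coefficient of \<open>w\<^sup>k/k!\<close> in the binomial series of the right-hand side is \<open>\<lambda>\<^sup>k \<langle>1/\<lambda>\<rangle>\<^sub>k\<close>. The
  Lah numbers turn this rising factorial into the falling factorials
  \<open>(1/\<lambda>)\<^sub>l = \<lambda>\<^bsup>-l\<^esup> (1)\<^bsub>l,\<lambda>\<^esub>\<close>, and the coefficients of \<open>w\<^sup>k/k!\<close> as a series in \<open>t\<close> are the
  Stirling numbers; comparing coefficients of \<open>t\<^sup>n/n!\<close> gives the claim.\<close>

section \<open>Power series expansions over the reals\<close>

text \<open>Differentiating \<open>n\<close> times moves the \<open>n\<close>-th coefficient, up to
  \<open>fact n\<close>, into the constant term, which is a function value. Hence \<open>f\<close>
  alone determines its series.\<close>

lemma fps_nth_has_fps_expansion: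
  fixes f :: "'a :: {banach, real_normed_field} \<Rightarrow> 'a"
  assumes "f has_fps_expansion F"
  shows "fps_nth F n = (deriv ^^ n) f 0 / fact n"
proof -
  have "(deriv ^^ n) f has_fps_expansion (fps_deriv ^^ n) F"
    using assms by (induction n) (auto intro: has_fps_expansion_deriv)
  then have "(deriv ^^ n) f 0 = fps_nth ((fps_deriv ^^ n) F) 0"
    by (auto simp: has_fps_expansion_def eval_fps_at_0 dest: eventually_nhds_x_imp_x)
  then show ?thesis
    by (simp add: fps_0th_higher_deriv)
qed

lemma has_fps_expansion_unique:
  fixes f :: "'a :: {banach, real_normed_field} \<Rightarrow> 'a"
  assumes "f has_fps_expansion F" "f has_fps_expansion G"
  shows "F = G"
  using assms by (simp add: fps_eq_iff fps_nth_has_fps_expansion)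

lemma has_fps_expansion_binomial_real:
  "(\<lambda>x::real. (1 + x) powr c) has_fps_expansion fps_binomial c"
proof (rule has_fps_expansionI)
  have "eventually (\<lambda>u::real. u \<in> ball 0 1) (nhds 0)"
    by (intro eventually_nhds_in_open) auto
  then show "eventually (\<lambda>u. (\<lambda>n. fps_nth (fps_binomial c) n * u ^ n) sums (1 + u) powr c) (nhds 0)"
    by eventually_elim (use gen_binomial_real in auto)
qed

text \<open>Coefficientwise embedding that preserves composition and convergence radius, so that
  identities of complex series descend to the real axis.\<close>

definition fps_complex_of_real :: "real fps \<Rightarrow> complex fps" where
  "fps_complex_of_real F = Abs_fps (\<lambda>n. of_real (fps_nth F n))"

lemma fps_nth_complex_of_real [simp]:
  "fps_nth (fps_complex_of_real F) n = of_real (fps_nth F n)"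
  by (simp add: fps_complex_of_real_def)

lemma fps_complex_of_real_power:
  "fps_complex_of_real (F ^ n) = fps_complex_of_real F ^ n"
proof (induction n)
  case (Suc n)
  then show ?case
    by (simp add: fps_eq_iff fps_mult_nth flip: Suc)
qed (auto simp: fps_eq_iff)

lemma fps_complex_of_real_compose:
  "fps_complex_of_real (F oo G) = fps_complex_of_real F oo fps_complex_of_real G"
  by (simp add: fps_eq_iff fps_compose_nth flip: fps_complex_of_real_power)

lemma fps_conv_radius_complex_of_real [simp]:
  "fps_conv_radius (fps_complex_of_real F) = fps_conv_radius F"
  unfolding fps_conv_radius_def by (rule conv_radius_cong) auto

lemma eval_fps_complex_of_real:
  assumes "ereal \<bar>x\<bar> < fps_conv_radius F"
  shows "eval_fps (fps_complex_of_real F) (of_real x) = of_real (eval_fps F x)"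
proof -
  have "complex_of_real (\<Sum>n. fps_nth F n * x ^ n) = (\<Sum>n. of_real (fps_nth F n * x ^ n))"
    using assms by (intro suminf_of_real summable_fps) simp
  then show ?thesis
    by (simp add: eval_fps_def)
qed

text \<open>The composition theorem of the library is restricted to complex functions.\<close>

lemma has_fps_expansion_compose_real:
  fixes f g :: "real \<Rightarrow> real"
  assumes F: "f has_fps_expansion F"
    and G: "g has_fps_expansion G" "fps_nth G 0 = 0"
  shows "(\<lambda>x. f (g x)) has_fps_expansion (F oo G)"
proof -
  let ?F = "fps_complex_of_real F" and ?G = "fps_complex_of_real G"
  have rF: "fps_conv_radius F > 0" and rG: "fps_conv_radius G > 0"
    and evF: "eventually (\<lambda>x. eval_fps F x = f x) (nhds 0)"
    and evG: "eventually (\<lambda>x. eval_fps G x = g x) (nhds 0)"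
    using F G by (auto simp: has_fps_expansion_def)
  \<comment> \<open>Compose over the complex numbers first; the embedding commutes with
    \<open>oo\<close>, so this yields both the radius of \<open>F oo G\<close> and its
    values.\<close>
  have "(eval_fps ?F \<circ> eval_fps ?G) has_fps_expansion (?F oo ?G)"
    by (intro has_fps_expansion_compose eval_fps_has_fps_expansion) (use rF rG G in auto)
  then have rFG: "fps_conv_radius (F oo G) > 0"
    and *: "eventually (\<lambda>z. eval_fps (fps_complex_of_real (F oo G)) z = eval_fps ?F (eval_fps ?G z))
              (nhds 0)"
    by (auto simp: has_fps_expansion_def simp flip: fps_complex_of_real_compose)
  have "((of_real :: real \<Rightarrow> complex) \<longlongrightarrow> of_real 0) (nhds 0)"
    by (intro tendsto_of_real filterlim_ident)
  then have ev: "eventually (\<lambda>x::real. eval_fps (fps_complex_of_real (F oo G)) (of_real x) =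
                    eval_fps ?F (eval_fps ?G (of_real x))) (nhds 0)"
    using eventually_compose_filterlim[OF *] by simp
  have near0: "eventually (\<lambda>x::real. x \<in> eball 0 r) (nhds 0)" if "r > 0" for r
    using that by (intro eventually_nhds_in_open) (auto simp: zero_ereal_def)
  have "g 0 = 0"
    using evG G(2) by (auto simp: eval_fps_at_0 dest: eventually_nhds_x_imp_x)
  moreover have "isCont g 0"
    using has_fps_expansion_imp_continuous[OF G(1), of UNIV] by simp
  ultimately have g0: "filterlim g (nhds 0) (nhds 0)"
    by (metis isCont_def tendsto_at_iff_tendsto_nhds)
  \<comment> \<open>Returning to real values requires \<open>x\<close> in the discs of
    \<open>G\<close> and \<open>F oo G\<close>, and \<open>g x\<close> in that of \<open>F\<close>;
    the last holds near 0 because \<open>g x\<close> tends to 0.\<close>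
  have "eventually (\<lambda>x. eval_fps (F oo G) x = f (g x)) (nhds 0)"
    using ev near0[OF rG] near0[OF rFG] evG
      eventually_compose_filterlim[OF near0[OF rF] g0] eventually_compose_filterlim[OF evF g0]
  proof eventually_elim
    case (elim x)
    then have "complex_of_real (eval_fps (F oo G) x) = of_real (f (g x))"
      by (simp add: eval_fps_complex_of_real in_eball_iff)
    then show ?case
      by (simp only: of_real_eq_iff)
  qed
  with rFG show ?thesis
    by (simp add: has_fps_expansion_def)
qed

section \<open>Falling factorials and Lah numbers\<close>

lemma deg_falling_0 [simp]: "deg_falling lam x 0 = 1"
  by (simp add: deg_falling_def)

lemma deg_falling_Suc: "deg_falling lam x (Suc n) = deg_falling lam x n * (x - real n * lam)"
  by (simp add: deg_falling_def)

lemma deg_falling_eq_falling: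
  assumes "lam \<noteq> 0"
  shows "deg_falling lam x n = lam ^ n * falling (x / lam) n"
  using assms by (induction n) (simp_all add: deg_falling_Suc field_simps)

lemma falling_of_nat_eq_0: "m < k \<Longrightarrow> falling (real m) k = 0"
  by (auto simp: deg_falling_def)

lemma falling_of_nat_self: "falling (real m) m \<noteq> 0"
  by (auto simp: deg_falling_def)

text \<open>The system is triangular: at \<open>x = m\<close> the terms with \<open>k > m\<close>
  vanish, those with \<open>k < m\<close> cancel by induction, and the factor at
  \<open>k = m\<close> is nonzero.\<close>

lemma falling_coeffs_unique:
  assumes "\<And>x. (\<Sum>k=0..n. c k * falling x k) = (\<Sum>k=0..n. d k * falling x k)"
    and "m \<le> n"
  shows "c m = d m"
  using \<open>m \<le> n\<close>
proof (induction m rule: less_induct)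
  case (less m)
  have "(\<Sum>k=0..n. (c k - d k) * falling (real m) k) = 0"
    using assms(1)[of "real m"] by (simp add: left_diff_distrib sum_subtractf)
  also have "(\<Sum>k=0..n. (c k - d k) * falling (real m) k) =
      (\<Sum>k\<in>{m}. (c k - d k) * falling (real m) k)"
    using less by (intro sum.mono_neutral_right)
      (auto simp: falling_of_nat_eq_0 not_less_iff_gr_or_eq neq_iff)
  finally show ?case
    using falling_of_nat_self by simp
qed

lemma ex_lah_coeffs:
  "\<exists>c. (\<forall>k>n. c k = 0) \<and> (\<forall>x::real. pochhammer x n = (\<Sum>k=0..n. c k * falling x k))"
proof (induction n)
  case 0
  show ?case
    by (rule exI[of _ "\<lambda>k. if k = 0 then 1 else 0"]) simp
next
  case (Suc n)
  then obtain c where c: "\<And>k. k > n \<Longrightarrow> c k = 0"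
    "\<And>x. pochhammer x n = (\<Sum>k=0..n. c k * falling x k)" by blast
  \<comment> \<open>Splitting \<open>x + n = (k + n) + (x - k)\<close> turns the factor
    \<open>x - k\<close> into a step from \<open>falling x k\<close> to
    \<open>falling x (Suc k)\<close>; this is the Lah recurrence.\<close>
  define d where
    "d k = (real k + real n) * c k + (case k of 0 \<Rightarrow> 0 | Suc j \<Rightarrow> c j)" for k
  have "pochhammer x (Suc n) = (\<Sum>k=0..Suc n. d k * falling x k)" for x
  proof -
    have "pochhammer x (Suc n) = (\<Sum>k=0..n. c k * falling x k * (x + real n))"
      by (simp add: pochhammer_Suc c sum_distrib_right)
    also have "\<dots> = (\<Sum>k=0..n. (real k + real n) * c k * falling x k + c k * falling x (Suc k))"
      by (intro sum.cong) (simp_all add: deg_falling_Suc algebra_simps)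
    \<comment> \<open>The added top term of the first sum is 0 since \<open>c (Suc n) = 0\<close>;
      the second sum is shifted by one.\<close>
    also have "\<dots> = (\<Sum>k=0..Suc n. (real k + real n) * c k * falling x k) +
        (\<Sum>k=0..Suc n. (case k of 0 \<Rightarrow> 0 | Suc j \<Rightarrow> c j) * falling x k)"
      by (subst (2) sum.atLeast0_atMost_Suc_shift) (simp add: sum.distrib c)
    also have "\<dots> = (\<Sum>k=0..Suc n. d k * falling x k)"
      by (simp only: d_def distrib_right sum.distrib)
    finally show ?thesis .
  qed
  moreover have "d k = 0" if "k > Suc n" for k
    using that c by (auto simp: d_def split: nat.split)
  ultimately show ?case by blast
qed

lemma pochhammer_eq_sum_lah: "pochhammer x n = (\<Sum>k=0..n. lah n k * falling x k)"
proof -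
  have "\<exists>!c. (\<forall>k>n. c k = 0) \<and> (\<forall>x::real. pochhammer x n = (\<Sum>k=0..n. c k * falling x k))"
  proof (rule ex_ex1I[OF ex_lah_coeffs])
    fix c d :: "nat \<Rightarrow> real"
    assume c: "(\<forall>k>n. c k = 0) \<and> (\<forall>x. pochhammer x n = (\<Sum>k=0..n. c k * falling x k))"
      and d: "(\<forall>k>n. d k = 0) \<and> (\<forall>x. pochhammer x n = (\<Sum>k=0..n. d k * falling x k))"
    show "c = d"
    proof
      fix k show "c k = d k"
        using c d falling_coeffs_unique[where c = c and d = d and n = n and m = k] by (cases "k \<le> n") auto
    qed
  qed
  from theI'[OF this] show ?thesis
    unfolding lah_def by blast
qed

text \<open>Setting \<open>x = 0\<close> isolates the coefficient at \<open>k = 0\<close>, while the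
  rising factorial vanishes there.\<close>

lemma lah_0_right:
  assumes "n > 0"
  shows "lah n 0 = 0"
proof -
  have "(\<Sum>k=0..n. lah n k * falling 0 k) = (\<Sum>k\<in>{0}. lah n k * falling 0 k)"
    using falling_of_nat_eq_0[of 0] by (intro sum.mono_neutral_right) auto
  with pochhammer_eq_sum_lah[of 0 n] assms show ?thesis
    by (simp add: pochhammer_0_left)
qed

section \<open>The degenerate moment generating function and its logarithm\<close>

lemma deg_mgf_has_fps_expansion:
  assumes "has_deg_mgfs M Y" "lam \<noteq> 0"
  shows "(\<lambda>t. prob_space.expectation M (\<lambda>\<omega>. deg_exp lam (Y \<omega>) t)) has_fps_expansion
    Abs_fps (\<lambda>n. prob_space.expectation M (\<lambda>\<omega>. deg_falling lam (Y \<omega>) n) / fact n)"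
proof (rule has_fps_expansionI)
  obtain r where r: "r > 0" "\<And>t. \<bar>t\<bar> < r \<Longrightarrow>
      (\<lambda>n. prob_space.expectation M (\<lambda>\<omega>. deg_falling lam (Y \<omega>) n) * t ^ n / fact n)
        sums prob_space.expectation M (\<lambda>\<omega>. deg_exp lam (Y \<omega>) t)"
    using assms unfolding has_deg_mgfs_def by blast
  have "eventually (\<lambda>t::real. t \<in> ball 0 r) (nhds 0)"
    using r(1) by (intro eventually_nhds_in_open) auto
  then show "\<forall>\<^sub>F t in nhds 0.
      (\<lambda>n. fps_nth (Abs_fps (\<lambda>n. prob_space.expectation M (\<lambda>\<omega>. deg_falling lam (Y \<omega>) n) / fact n)) n
        * t ^ n) sums prob_space.expectation M (\<lambda>\<omega>. deg_exp lam (Y \<omega>) t)"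
    by eventually_elim (use r(2) in simp)
qed

text \<open>Since \<open>f 0 = 1\<close>, the power is expanded by the binomial series in
  \<open>f - 1\<close>. The zero constant term of \<open>W\<close> is what allows \<open>W\<close>
  to be substituted into further series.\<close>

lemma deg_log_has_fps_expansion:
  assumes "f has_fps_expansion F" "fps_nth F 0 = 1" "mu \<noteq> 0"
  obtains W where "(\<lambda>t. deg_log mu (f t)) has_fps_expansion W" "fps_nth W 0 = 0"
proof
  let ?W = "((fps_binomial mu oo (F - 1)) - 1) * fps_const (1 / mu)"
  have "(\<lambda>t. (1 + (f t - 1)) powr mu) has_fps_expansion (fps_binomial mu oo (F - 1))"
    using assms by (intro has_fps_expansion_compose_real[OF has_fps_expansion_binomial_real]
        has_fps_expansion_diff has_fps_expansion_1) auto
  then have "(\<lambda>t. ((1 + (f t - 1)) powr mu - 1) * (1 / mu)) has_fps_expansion ?W"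
    by (intro has_fps_expansion_cmult_right has_fps_expansion_diff has_fps_expansion_1)
  then show "(\<lambda>t. deg_log mu (f t)) has_fps_expansion ?W"
    by (simp add: deg_log_def)
qed simp

lemma deg_log_inverse:
  assumes "u > 0" "mu \<noteq> 0"
  shows "(1 + mu * deg_log mu u) powr (1 / mu) = u"
  using assms by (simp add: deg_log_def powr_powr)

text \<open>Both sides expand the same function near 0, by \<open>deg_log_inverse\<close>, so they
  agree as formal series.\<close>

lemma deg_log_fps_inverse:
  assumes f: "f has_fps_expansion F" "fps_nth F 0 = 1" and "mu \<noteq> 0"
    and W: "(\<lambda>t. deg_log mu (f t)) has_fps_expansion W" "fps_nth W 0 = 0"
  shows "F = fps_binomial (1 / mu) oo (fps_const mu * W)"
proof -
  have "(\<lambda>t. (1 + mu * deg_log mu (f t)) powr (1 / mu)) has_fps_expansion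
      (fps_binomial (1 / mu) oo (fps_const mu * W))"
    using W by (intro has_fps_expansion_compose_real[OF has_fps_expansion_binomial_real]
        has_fps_expansion_cmult_left) auto
  moreover have "f 0 = 1"
    using f by (auto simp: has_fps_expansion_def eval_fps_at_0 dest: eventually_nhds_x_imp_x)
  then have "(f \<longlongrightarrow> 1) (nhds 0)"
    using has_fps_expansion_imp_continuous[OF f(1), of UNIV]
    by (metis isCont_def tendsto_at_iff_tendsto_nhds)
  \<comment> \<open>Positivity, needed to invert the logarithm, comes from continuity and
    \<open>f 0 = 1\<close>.\<close>
  then have "eventually (\<lambda>t. f t > 0) (nhds 0)"
    by (rule order_tendstoD) simp
  then have "eventually (\<lambda>t. (1 + mu * deg_log mu (f t)) powr (1 / mu) = f t) (nhds 0)"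
    by eventually_elim (use \<open>mu \<noteq> 0\<close> in \<open>simp add: deg_log_inverse\<close>)
  ultimately have "f has_fps_expansion (fps_binomial (1 / mu) oo (fps_const mu * W))"
    by (subst (asm) has_fps_expansion_cong[OF _ refl]) auto
  with f show ?thesis
    by (intro has_fps_expansion_unique)
qed

lemma prob_deg_stirling1_eq:
  assumes W: "(\<lambda>t. deg_log (- lam) (prob_space.expectation M (\<lambda>\<omega>. deg_exp lam (Y \<omega>) t)))
      has_fps_expansion W" "fps_nth W 0 = 0"
    and "k \<le> n"
  shows "(- 1) ^ (n - k) * prob_deg_stirling1 M Y lam n k = fact n * fps_nth (W ^ k) n / fact k"
proof -
  let ?f = "\<lambda>t. 1 / fact k *
    (deg_log (- lam) (prob_space.expectation M (\<lambda>\<omega>. deg_exp lam (Y \<omega>) t))) ^ k"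
  let ?F = "fps_const (1 / fact k) * W ^ k"
  let ?A = "\<lambda>s. Abs_fps (\<lambda>m. if k \<le> m then (- 1) ^ (m - k) * s m / fact m else 0 :: real)"
  \<comment> \<open>Obtained by solving the coefficient equation for \<open>s m\<close>; the sign is
    its own inverse.\<close>
  define c where "c m = (if m < k then 0 else (- 1) ^ (m - k) * fact m * fps_nth (W ^ k) m / fact k)"
    for m
  have F: "?f has_fps_expansion ?F"
    using W by (intro has_fps_expansion_cmult_left has_fps_expansion_power)
  \<comment> \<open>Below index \<open>k\<close> both series vanish, because \<open>W\<close> has no
    constant term and so \<open>W ^ k\<close> starts at order \<open>k\<close>.\<close>
  have "?A c = ?F"
    using startsby_zero_power_prefix[OF W(2)]
    by (auto simp: fps_eq_iff c_def not_le simp flip: power_add mult.assoc)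
  with F have ex: "(\<forall>m<k. c m = 0) \<and> ?f has_fps_expansion ?A c"
    by (simp add: c_def)
  have "(THE s. (\<forall>m<k. s m = 0) \<and> ?f has_fps_expansion ?A s) = c"
  proof (rule the_equality)
    show "(\<forall>m<k. c m = 0) \<and> ?f has_fps_expansion ?A c" by (fact ex)
  next
    fix s assume s: "(\<forall>m<k. s m = 0) \<and> ?f has_fps_expansion ?A s"
    have eq: "?A s = ?A c"
      using s ex has_fps_expansion_unique by blast
    show "s = c"
    proof
      fix m show "s m = c m"
        using arg_cong[OF eq, of "\<lambda>F. fps_nth F m"] s ex by (cases "k \<le> m") auto
    qed
  qed
  then have "prob_deg_stirling1 M Y lam n k = c n"
    by (simp add: prob_deg_stirling1_def)
  with \<open>k \<le> n\<close> show ?thesis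
    by (simp add: c_def flip: power_add mult.assoc)
qed

text \<open>The signs of the binomial coefficient and of the power cancel. The case of interest is
  \<open>a = 1 / lam\<close>, \<open>b = lam\<close>.\<close>

lemma gbinomial_mult_power_eq_pochhammer:
  fixes a :: "'a :: field_char_0"
  shows "((- a) gchoose k) * (- b) ^ k = b ^ k * pochhammer a k / fact k"
  by (simp add: gbinomial_pochhammer power_minus[of b] flip: power_add mult.assoc)

theorem theorem2p6:
  fixes M :: "'a measure" and Y :: "'a \<Rightarrow> real" and lam :: real and n :: nat
  assumes "prob_space M"
    and "Y \<in> borel_measurable M"
    and "has_deg_mgfs M Y"
    and "lam \<noteq> 0"
    and "n \<ge> 1"
  shows "prob_space.expectation M (\<lambda>\<omega>. deg_falling lam (Y \<omega>) n) =
    (\<Sum>l=1..n. \<Sum>k=l..n. lam ^ (k - l) * (- 1) ^ (n - k) * deg_falling lam 1 l *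
       prob_deg_stirling1 M Y lam n k * lah k l)"
proof -
  let ?S = "prob_deg_stirling1 M Y lam n"
  let ?f = "\<lambda>t. prob_space.expectation M (\<lambda>\<omega>. deg_exp lam (Y \<omega>) t)"
  define F where
    "F = Abs_fps (\<lambda>n. prob_space.expectation M (\<lambda>\<omega>. deg_falling lam (Y \<omega>) n) / fact n)"
  have F: "?f has_fps_expansion F"
    unfolding F_def using assms by (intro deg_mgf_has_fps_expansion)
  have F0: "fps_nth F 0 = 1"
    using prob_space.prob_space[OF \<open>prob_space M\<close>] by (simp add: F_def)
  obtain W where W: "(\<lambda>t. deg_log (- lam) (?f t)) has_fps_expansion W" "fps_nth W 0 = 0"
    using deg_log_has_fps_expansion[OF F F0, of "- lam"] \<open>lam \<noteq> 0\<close> by auto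
  have FW: "F = fps_binomial (1 / (- lam)) oo (fps_const (- lam) * W)"
    using deg_log_fps_inverse[OF F F0 _ W] \<open>lam \<noteq> 0\<close> by simp

  have "prob_space.expectation M (\<lambda>\<omega>. deg_falling lam (Y \<omega>) n) = fact n * fps_nth F n"
    by (simp add: F_def)
  also have "\<dots> = (\<Sum>k=0..n. fact n * (((- (1 / lam)) gchoose k) * (- lam) ^ k * fps_nth (W ^ k) n))"
    unfolding FW
    by (simp add: fps_compose_nth power_mult_distrib fps_const_power sum_distrib_left mult.assoc
             del: fps_const_neg)
  also have "\<dots> = (\<Sum>k=0..n. lam ^ k * pochhammer (1 / lam) k * ((- 1) ^ (n - k) * ?S k))"
    by (intro sum.cong)
       (simp_all add: gbinomial_mult_power_eq_pochhammer prob_deg_stirling1_eq[OF W])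
  \<comment> \<open>The term \<open>k = 0\<close> drops out: \<open>W ^ 0 = 1\<close> has zero
    coefficient at \<open>n \<ge> 1\<close>.\<close>
  also have "\<dots> = (\<Sum>k=1..n. lam ^ k * pochhammer (1 / lam) k * ((- 1) ^ (n - k) * ?S k))"
    using \<open>n \<ge> 1\<close> prob_deg_stirling1_eq[OF W, of 0 n]
    by (simp add: sum.atLeast_Suc_atMost)
  also have "\<dots> = (\<Sum>k=1..n. \<Sum>l=1..k. lam ^ (k - l) * (- 1) ^ (n - k) * deg_falling lam 1 l *
       ?S k * lah k l)"
  proof (intro sum.cong refl)
    fix k assume k: "k \<in> {1..n}"
    have "pochhammer (1 / lam) k = (\<Sum>l=1..k. lah k l * falling (1 / lam) l)"
      using k by (simp add: pochhammer_eq_sum_lah sum.atLeast_Suc_atMost lah_0_right)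
    \<comment> \<open>The factor \<open>lam ^ l\<close> combines with
      \<open>falling (1 / lam) l\<close> to give \<open>deg_falling lam 1 l\<close>.\<close>
    moreover have "lam ^ k = lam ^ (k - l) * lam ^ l" if "l \<le> k" for l
      using that by (simp flip: power_add)
    ultimately show "lam ^ k * pochhammer (1 / lam) k * ((- 1) ^ (n - k) * ?S k) =
        (\<Sum>l=1..k. lam ^ (k - l) * (- 1) ^ (n - k) * deg_falling lam 1 l * ?S k * lah k l)"
      by (auto simp: sum_distrib_left sum_distrib_right deg_falling_eq_falling[OF \<open>lam \<noteq> 0\<close>]
               intro!: sum.cong)
  qed
  \<comment> \<open>Interchange of summation over the triangle
    \<open>1 \<le> l \<le> k \<le> n\<close>.\<close>
  also have "\<dots> = (\<Sum>l=1..n. \<Sum>k=l..n. lam ^ (k - l) * (- 1) ^ (n - k) * deg_falling lam 1 l *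
       ?S k * lah k l)"
    unfolding sum.Sigma[OF finite_atLeastAtMost ballI[OF finite_atLeastAtMost]]
    by (intro sum.reindex_bij_witness[of _ "\<lambda>(a, b). (b, a)" "\<lambda>(a, b). (b, a)"]) auto
  finally show ?thesis .
qed

end
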